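(* Let $(X,\mu,\nu,\ast,\diamond)$ be an M-complete non-Archimedean intuitionistic fuzzy metric space, let $\psi\in\Psi$ and $\phi\in\Phi$, and let $f:X\to X$ be an intuitionistic fuzzy $\psi$-$\phi$-contractive mapping. If there exists $x\in X$ such that $\mu(x,f(x),t)>0$ and $\nu(x,f(x),t)<1$ for all $t>0$, then $f$ has a unique fixed point.
   Context: A continuous t-norm is a continuous, commutative, associative operation $\ast:[0,1]\times[0,1]\to[0,1]$ with $a\ast 1=a$ for all $a$, and $a\ast b\le c\ast d$ whenever $a\le c$, $b\le d$. A continuous t-conorm is a continuous, commutative, associative operation $\diamond:[0,1]\times[0,1]\to[0,1]$ with $a\diamond 0=a$ for all $a$, and $a\diamond b\le c\diamond d$ whenever $a\le c$, $b\le d$. A non-Archimedean intuitionistic fuzzy metric space is a 5-tuple $(X,\mu,\nu,\ast,\diamond)$ where $X$ is a set, $\ast$ is a continuous t-norm, $\diamond$ is a continuous t-conorm, and $\mu,\nu: X^2\times(0,\infty)\to[0,1]$ satisfy, for all $x,y,z\in X$ and $s,t>0$: (i) $\mu(x,y,t)+\nu(x,y,t)\le 1$; (ii) $\mu(x,y,t)>0$; (iii) $\mu(x,y,t)=1$ if and only if $x=y$; (iv) $\mu(x,y,t)=\mu(y,x,t)$; (v) $\mu(x,z,\max\{t,s\})\ge\mu(x,y,t)\ast\mu(y,z,s)$; (vi) $\mu(x,y,\cdot):(0,\infty)\to(0,1]$ is continuous; (vii) $\nu(x,y,t)=0$ if and only if $x=y$; (viii) $\nu(x,y,t)=\nu(y,x,t)$;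 (ix) $\nu(x,z,\max\{t,s\})\le\nu(x,y,t)\diamond\nu(y,z,s)$; (x) $\nu(x,y,\cdot):(0,\infty)\to[0,1]$ is continuous. A sequence $\{x_n\}$ in $X$ converges to $x\in X$ if $\lim_{n\to\infty}\mu(x_n,x,t)=1$ and $\lim_{n\to\infty}\nu(x_n,x,t)=0$ for all $t>0$. It is M-Cauchy if for each $\epsilon\in(0,1)$ and $t>0$ there is $n_0\in\mathbb{N}$ such that $\mu(x_n,x_m,t)>1-\epsilon$ and $\nu(x_n,x_m,t)<\epsilon$ for all $m,n\ge n_0$. The space is M-complete if every M-Cauchy sequence converges in $X$. $\Psi$ is the class of all continuous, non-decreasing maps $\psi:[0,1]\to[0,1]$ with $\psi(t)<t$ for all $t\in(0,1)$. $\Phi$ is the class of all continuous, non-decreasing maps $\phi:[0,1]\to[0,1]$ with $\phi(t)>t$ for all $t\in(0,1)$. For $\psi\in\Psi$, $\phi\in\Phi$, a map $f:X\to X$ is intuitionistic fuzzy $\psi$-$\phi$-contractive if for all $x,y\in X$ and $t>0$: $\mu(x,y,t)>0$ implies $\psi(\mu(f(x),f(y),t))\ge\mu(x,y,t)$, and $\nu(x,y,t)<1$ implies $\phi(\nu(f(x),f(y),t))\le\nu(x,y,t)$. *)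

theory Defs
  imports "HOL-Analysis.Analysis"
begin

text \<open>
  Operations on \<open>[0,1]\<close> are total functions on the reals of which only the restriction to
  \<open>{0..1}\<close> matters, and spaces carry an explicit carrier set \<open>X\<close>. Likewise \<open>\<mu> x y t\<close> and
  \<open>\<nu> x y t\<close> matter only for \<open>x, y \<in> X\<close> and \<open>t > 0\<close>.
\<close>

definition continuous_tnorm :: "(real \<Rightarrow> real \<Rightarrow> real) \<Rightarrow> bool" where
  "continuous_tnorm T \<longleftrightarrow>
     (\<forall>a\<in>{0..1}. \<forall>b\<in>{0..1}. T a b \<in> {0..1}) \<and>
     continuous_on ({0..1} \<times> {0..1}) (\<lambda>(a, b). T a b) \<and>
     (\<forall>a\<in>{0..1}. \<forall>b\<in>{0..1}. T a b = T b a) \<and>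
     (\<forall>a\<in>{0..1}. \<forall>b\<in>{0..1}. \<forall>c\<in>{0..1}. T (T a b) c = T a (T b c)) \<and>
     (\<forall>a\<in>{0..1}. T a 1 = a) \<and>
     (\<forall>a\<in>{0..1}. \<forall>b\<in>{0..1}. \<forall>c\<in>{0..1}. \<forall>d\<in>{0..1}. a \<le> c \<longrightarrow> b \<le> d \<longrightarrow> T a b \<le> T c d)"

definition continuous_tconorm :: "(real \<Rightarrow> real \<Rightarrow> real) \<Rightarrow> bool" where
  "continuous_tconorm S \<longleftrightarrow>
     (\<forall>a\<in>{0..1}. \<forall>b\<in>{0..1}. S a b \<in> {0..1}) \<and>
     continuous_on ({0..1} \<times> {0..1}) (\<lambda>(a, b). S a b) \<and>
     (\<forall>a\<in>{0..1}. \<forall>b\<in>{0..1}. S a b = S b a) \<and>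
     (\<forall>a\<in>{0..1}. \<forall>b\<in>{0..1}. \<forall>c\<in>{0..1}. S (S a b) c = S a (S b c)) \<and>
     (\<forall>a\<in>{0..1}. S a 0 = a) \<and>
     (\<forall>a\<in>{0..1}. \<forall>b\<in>{0..1}. \<forall>c\<in>{0..1}. \<forall>d\<in>{0..1}. a \<le> c \<longrightarrow> b \<le> d \<longrightarrow> S a b \<le> S c d)"

locale nonarch_ifm_space =
  fixes X :: "'a set"
    and \<mu> \<nu> :: "'a \<Rightarrow> 'a \<Rightarrow> real \<Rightarrow> real"
    and T S :: "real \<Rightarrow> real \<Rightarrow> real"
  assumes tnorm: "continuous_tnorm T"
    and tconorm: "continuous_tconorm S"
    and mu_range: "\<lbrakk>x \<in> X; y \<in> X; t > 0\<rbrakk> \<Longrightarrow> \<mu> x y t \<in> {0..1}"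
    and nu_range: "\<lbrakk>x \<in> X; y \<in> X; t > 0\<rbrakk> \<Longrightarrow> \<nu> x y t \<in> {0..1}"
    and mu_nu_le_1: "\<lbrakk>x \<in> X; y \<in> X; t > 0\<rbrakk> \<Longrightarrow> \<mu> x y t + \<nu> x y t \<le> 1"
    and mu_pos: "\<lbrakk>x \<in> X; y \<in> X; t > 0\<rbrakk> \<Longrightarrow> \<mu> x y t > 0"
    and mu_eq_1_iff: "\<lbrakk>x \<in> X; y \<in> X; t > 0\<rbrakk> \<Longrightarrow> \<mu> x y t = 1 \<longleftrightarrow> x = y"
    and mu_sym: "\<lbrakk>x \<in> X; y \<in> X; t > 0\<rbrakk> \<Longrightarrow> \<mu> x y t = \<mu> y x t"
    and mu_triangle: "\<lbrakk>x \<in> X; y \<in> X; z \<in> X; t > 0; s > 0\<rbrakk>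
           \<Longrightarrow> \<mu> x z (max t s) \<ge> T (\<mu> x y t) (\<mu> y z s)"
    and mu_continuous: "\<lbrakk>x \<in> X; y \<in> X\<rbrakk> \<Longrightarrow> continuous_on {0<..} (\<mu> x y)"
    and nu_eq_0_iff: "\<lbrakk>x \<in> X; y \<in> X; t > 0\<rbrakk> \<Longrightarrow> \<nu> x y t = 0 \<longleftrightarrow> x = y"
    and nu_sym: "\<lbrakk>x \<in> X; y \<in> X; t > 0\<rbrakk> \<Longrightarrow> \<nu> x y t = \<nu> y x t"
    and nu_triangle: "\<lbrakk>x \<in> X; y \<in> X; z \<in> X; t > 0; s > 0\<rbrakk>
           \<Longrightarrow> \<nu> x z (max t s) \<le> S (\<nu> x y t) (\<nu> y z s)"
    and nu_continuous: "\<lbrakk>x \<in> X; y \<in> X\<rbrakk> \<Longrightarrow> continuous_on {0<..} (\<nu> x y)"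

definition ifm_converges ::
  "('a \<Rightarrow> 'a \<Rightarrow> real \<Rightarrow> real) \<Rightarrow> ('a \<Rightarrow> 'a \<Rightarrow> real \<Rightarrow> real) \<Rightarrow> (nat \<Rightarrow> 'a) \<Rightarrow> 'a \<Rightarrow> bool" where
  "ifm_converges \<mu> \<nu> u x \<longleftrightarrow>
     (\<forall>t>0. (\<lambda>n. \<mu> (u n) x t) \<longlonglongrightarrow> 1 \<and> (\<lambda>n. \<nu> (u n) x t) \<longlonglongrightarrow> 0)"

definition M_Cauchy ::
  "('a \<Rightarrow> 'a \<Rightarrow> real \<Rightarrow> real) \<Rightarrow> ('a \<Rightarrow> 'a \<Rightarrow> real \<Rightarrow> real) \<Rightarrow> (nat \<Rightarrow> 'a) \<Rightarrow> bool" where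
  "M_Cauchy \<mu> \<nu> u \<longleftrightarrow>
     (\<forall>\<epsilon>\<in>{0<..<1}. \<forall>t>0. \<exists>n0. \<forall>m\<ge>n0. \<forall>n\<ge>n0.
        \<mu> (u n) (u m) t > 1 - \<epsilon> \<and> \<nu> (u n) (u m) t < \<epsilon>)"

definition M_complete ::
  "'a set \<Rightarrow> ('a \<Rightarrow> 'a \<Rightarrow> real \<Rightarrow> real) \<Rightarrow> ('a \<Rightarrow> 'a \<Rightarrow> real \<Rightarrow> real) \<Rightarrow> bool" where
  "M_complete X \<mu> \<nu> \<longleftrightarrow>
     (\<forall>u. (\<forall>n. u n \<in> X) \<and> M_Cauchy \<mu> \<nu> u \<longrightarrow> (\<exists>x\<in>X. ifm_converges \<mu> \<nu> u x))"

definition Psi_class :: "(real \<Rightarrow> real) set" where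
  "Psi_class = {\<psi>. \<psi> \<in> {0..1} \<rightarrow> {0..1} \<and> continuous_on {0..1} \<psi> \<and> mono_on {0..1} \<psi> \<and>
     (\<forall>t\<in>{0<..<1}. \<psi> t < t)}"

definition Phi_class :: "(real \<Rightarrow> real) set" where
  "Phi_class = {\<phi>. \<phi> \<in> {0..1} \<rightarrow> {0..1} \<and> continuous_on {0..1} \<phi> \<and> mono_on {0..1} \<phi> \<and>
     (\<forall>t\<in>{0<..<1}. \<phi> t > t)}"

definition if_contractive ::
  "'a set \<Rightarrow> ('a \<Rightarrow> 'a \<Rightarrow> real \<Rightarrow> real) \<Rightarrow> ('a \<Rightarrow> 'a \<Rightarrow> real \<Rightarrow> real) \<Rightarrow>
   (real \<Rightarrow> real) \<Rightarrow> (real \<Rightarrow> real) \<Rightarrow> ('a \<Rightarrow> 'a) \<Rightarrow> bool" where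
  "if_contractive X \<mu> \<nu> \<psi> \<phi> f \<longleftrightarrow>
     (\<forall>x\<in>X. \<forall>y\<in>X. \<forall>t>0.
        (\<mu> x y t > 0 \<longrightarrow> \<psi> (\<mu> (f x) (f y) t) \<ge> \<mu> x y t) \<and>
        (\<nu> x y t < 1 \<longrightarrow> \<phi> (\<nu> (f x) (f y) t) \<le> \<nu> x y t))"

end

theory Submission
  imports Defs
begin

text \<open>
  Let \<open>u\<^sub>n = f\<^sup>n x\<^sub>0\<close>. The numbers \<open>\<mu> u\<^sub>n u\<^bsub>n+1\<^esub> t\<close> increase to a limit \<open>L > 0\<close> with \<open>L \<le> \<psi> L\<close>, so
  \<open>L = 1\<close>. For \<open>0 < r < 1\<close>, continuity of \<open>\<psi>\<close> at \<open>r\<close> gives \<open>r' > r\<close> such that \<open>\<psi> s \<ge> r\<close> forces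
  \<open>s \<ge> r'\<close>; hence \<open>\<mu> u\<^sub>n y t \<ge> r\<close> implies \<open>\<mu> u\<^sub>n (f y) t \<ge> T (\<mu> u\<^sub>n u\<^bsub>n+1\<^esub> t) r' \<ge> r\<close> once \<open>n\<close> is large,
  that is, the closed ball of level \<open>r\<close> about \<open>u\<^sub>n\<close> is invariant under \<open>f\<close> and contains all later
  iterates. The conjugation \<open>a \<mapsto> 1 - a\<close> turns \<open>S\<close>, \<open>\<phi>\<close>, \<open>\<nu>\<close> into data of the same kind as
  \<open>T\<close>, \<open>\<psi>\<close>, \<open>\<mu>\<close>, so the orbit is Cauchy for both, and its limit is fixed.
\<close>

section \<open>Functions of class \<open>Psi_class\<close>\<close>

lemma Psi_class_le:
  assumes "\<psi> \<in> Psi_class" "s \<in> {0..1}"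
  shows "\<psi> s \<le> s"
proof -
  have rng: "\<psi> s \<in> {0..1}" if "s \<in> {0..1}" for s
    using assms that by (auto simp: Psi_class_def)
  have lt: "\<psi> s < s" if "s \<in> {0<..<1}" for s
    using assms that by (auto simp: Psi_class_def)
  have mono: "mono_on {0..1} \<psi>"
    using assms by (auto simp: Psi_class_def)
  \<comment> \<open>The class bounds \<psi> strictly only inside the interval. If
    \<open>\<psi> 0\<close> were positive, monotonicity would violate that bound at the interior
    point \<open>\<psi> 0 / 2\<close>. At 1 the range suffices.\<close>
  have "\<psi> 0 \<le> 0"
  proof (rule ccontr)
    assume "\<not> \<psi> 0 \<le> 0"
    moreover have "\<psi> 0 \<le> \<psi> (\<psi> 0 / 2)"
      using rng[of 0] by (intro mono_onD[OF mono]) auto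
    ultimately show False
      using lt[of "\<psi> 0 / 2"] rng[of 0] by auto
  qed
  then show ?thesis
    using rng[of s] lt[of s] assms(2) by (cases "s = 0 \<or> s = 1") auto
qed

lemma Psi_class_le_imp_eq_1:
  assumes "\<psi> \<in> Psi_class" "s \<in> {0<..1}" "s \<le> \<psi> s"
  shows "s = 1"
proof (rule ccontr)
  assume "s \<noteq> 1"
  then have "\<psi> s < s"
    using assms by (auto simp: Psi_class_def)
  then show False
    using assms(3) by simp
qed

lemma Psi_class_gap:
  assumes "\<psi> \<in> Psi_class" "r \<in> {0<..<1}"
  obtains r' where "r < r'" "r' \<le> 1" "\<And>s. s \<in> {0..1} \<Longrightarrow> r \<le> \<psi> s \<Longrightarrow> r' \<le> s"
proof -
  have lt: "\<psi> r < r" and mono: "mono_on {0..1} \<psi>" and cont: "continuous_on {0..1} \<psi>"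
    using assms by (auto simp: Psi_class_def)
  obtain d where d: "d > 0" "\<And>s. s \<in> {0..1} \<Longrightarrow> dist s r < d \<Longrightarrow> dist (\<psi> s) (\<psi> r) < r - \<psi> r"
    using cont[unfolded continuous_on_iff, rule_format, of r "r - \<psi> r"] assms(2) lt by auto
  \<comment> \<open>Monotonicity excludes \<open>s \<le> r\<close>, continuity with tolerance
    \<open>r - \<psi> r\<close> excludes \<open>r < s < r + d\<close>. The cap at 1 keeps the
    witness a legitimate t-norm argument.\<close>
  have "min 1 (r + d) \<le> s" if s: "s \<in> {0..1}" "r \<le> \<psi> s" for s
  proof (rule ccontr)
    assume "\<not> min 1 (r + d) \<le> s"
    then have "s < r + d" by auto
    show False
    proof (cases "s \<le> r")
      case True
      then have "\<psi> s \<le> \<psi> r"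
        using s assms(2) by (intro mono_onD[OF mono]) auto
      then show ?thesis using lt s by simp
    next
      case False
      then show ?thesis
        using d(2)[of s] s \<open>s < r + d\<close> by (auto simp: dist_real_def)
    qed
  qed
  then show thesis
    using d(1) assms(2) by (intro that[of "min 1 (r + d)"]) auto
qed

text \<open>The limit 0 also satisfies \<open>L \<le> \<psi> L\<close>; the positive start of an
  increasing sequence rules it out.\<close>

lemma Psi_class_LIMSEQ_1:
  assumes psi: "\<psi> \<in> Psi_class"
    and rng: "\<And>n. a n \<in> {0..1}"
    and pos: "a 0 > 0"
    and step: "\<And>n. a n > 0 \<Longrightarrow> a n \<le> \<psi> (a (Suc n))"
  shows "a \<longlonglongrightarrow> 1"
proof -
  have inc: "a n \<le> a (Suc n)" for n
  proof (cases "a n > 0")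
    case True
    then show ?thesis
      using step[of n] Psi_class_le[OF psi rng[of "Suc n"]] by linarith
  next
    case False
    then show ?thesis using rng[of "Suc n"] by auto
  qed
  then have "incseq a" by (rule incseq_SucI)
  then obtain L where L: "a \<longlonglongrightarrow> L" "\<And>n. a n \<le> L"
    using rng by (metis incseq_convergent atLeastAtMost_iff)
  have "L \<le> 1"
    using L(1) rng by (intro LIMSEQ_le_const2) auto
  have "L > 0"
    using L(2)[of 0] pos by simp
  have "a n > 0" for n
    using \<open>incseq a\<close> pos by (metis incseqD le0 less_le_trans)
  then have le: "a n \<le> \<psi> (a (Suc n))" for n
    by (rule step)
  have cont: "continuous_on {0..1} \<psi>"
    using psi by (auto simp: Psi_class_def)
  have "(\<lambda>n. \<psi> (a (Suc n))) \<longlonglongrightarrow> \<psi> L"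
    using rng \<open>L \<le> 1\<close> \<open>L > 0\<close>
    by (intro continuous_on_tendsto_compose[OF cont LIMSEQ_Suc[OF L(1)]]) auto
  then have "L \<le> \<psi> L"
    using le by (intro LIMSEQ_le[OF L(1)]) auto
  then have "L = 1"
    using Psi_class_le_imp_eq_1[OF psi] \<open>L \<le> 1\<close> \<open>L > 0\<close> by auto
  then show ?thesis using L(1) by simp
qed

section \<open>Limits under a t-norm and Cauchy orbits\<close>

lemma continuous_tnorm_LIMSEQ:
  assumes T: "continuous_tnorm T"
    and a: "a \<longlonglongrightarrow> 1" "\<And>n. a n \<in> {0..1}"
    and b: "b \<longlonglongrightarrow> l" "\<And>n. b n \<in> {0..1}"
  shows "(\<lambda>n. T (a n) (b n)) \<longlonglongrightarrow> l"
proof -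
  have cont: "continuous_on ({0..1} \<times> {0..1}) (\<lambda>(a, b). T a b)"
    and comm: "\<forall>a\<in>{0..1}. \<forall>b\<in>{0..1}. T a b = T b a"
    and unit: "\<forall>a\<in>{0..1}. T a 1 = a"
    using T by (simp_all add: continuous_tnorm_def)
  have l: "l \<in> {0..1}"
    by (rule closed_sequentially[OF closed_atLeastAtMost b(2) b(1)])
  have "(\<lambda>n. (\<lambda>(a, b). T a b) (a n, b n)) \<longlonglongrightarrow> (\<lambda>(a, b). T a b) (1, l)"
    using a b l by (intro continuous_on_tendsto_compose[OF cont] tendsto_Pair) auto
  \<comment> \<open>The unit law has 1 on the right; commutativity moves it to the left.\<close>
  moreover have "T 1 l = l"
    using bspec[OF bspec[OF comm l], of 1] bspec[OF unit l] by simp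
  ultimately show ?thesis by simp
qed

text \<open>Here \<open>d\<close> stands for \<mu>, or for 1 - \<nu>, at one fixed parameter t:
  since \<open>max t t = t\<close>, the non-Archimedean triangle inequality holds for each t
  separately.\<close>

lemma orbit_Cauchy:
  fixes d :: "'a \<Rightarrow> 'a \<Rightarrow> real"
  assumes T: "continuous_tnorm T" and psi: "\<psi> \<in> Psi_class"
    and f: "f \<in> X \<rightarrow> X" and x0: "x0 \<in> X" "d x0 (f x0) > 0"
    and rng: "\<And>x y. x \<in> X \<Longrightarrow> y \<in> X \<Longrightarrow> d x y \<in> {0..1}"
    and refl: "\<And>x. x \<in> X \<Longrightarrow> d x x = 1"
    and tri: "\<And>x y z. x \<in> X \<Longrightarrow> y \<in> X \<Longrightarrow> z \<in> X \<Longrightarrow> T (d x y) (d y z) \<le> d x z"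
    and contr: "\<And>x y. x \<in> X \<Longrightarrow> y \<in> X \<Longrightarrow> d x y > 0 \<Longrightarrow> d x y \<le> \<psi> (d (f x) (f y))"
    and r: "r \<in> {0<..<1}"
  shows "\<forall>\<^sub>F n in sequentially. \<forall>m\<ge>n. r \<le> d ((f ^^ n) x0) ((f ^^ m) x0)"
proof -
  define u where "u n = (f ^^ n) x0" for n
  have T_mono: "T a b \<le> T c e"
    if "a \<in> {0..1}" "b \<in> {0..1}" "c \<in> {0..1}" "e \<in> {0..1}" "a \<le> c" "b \<le> e" for a b c e
    using T that by (simp add: continuous_tnorm_def)
  have uX: "u n \<in> X" for n
    using f x0(1) by (induction n) (auto simp: u_def)
  have u_Suc: "u (Suc n) = f (u n)" for n
    by (simp add: u_def)
  have lim: "(\<lambda>n. d (u n) (u (Suc n))) \<longlonglongrightarrow> 1"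
  proof (rule Psi_class_LIMSEQ_1[OF psi])
    show "d (u 0) (u (Suc 0)) > 0"
      using x0 by (simp add: u_def)
    show "d (u n) (u (Suc n)) \<le> \<psi> (d (u (Suc n)) (u (Suc (Suc n))))"
      if "d (u n) (u (Suc n)) > 0" for n
      using contr[OF uX uX that] by (simp add: u_Suc)
  qed (rule rng[OF uX uX])
  obtain r' where r': "r < r'" "r' \<le> 1" "\<And>s. s \<in> {0..1} \<Longrightarrow> r \<le> \<psi> s \<Longrightarrow> r' \<le> s"
    using Psi_class_gap[OF psi r] by blast
  \<comment> \<open>The gap \<open>r < r'\<close> absorbs the loss in the triangle inequality. The
    resulting threshold on n does not involve m.\<close>
  have "(\<lambda>n. T (d (u n) (u (Suc n))) r') \<longlonglongrightarrow> r'"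
    using r r' rng[OF uX uX] by (intro continuous_tnorm_LIMSEQ[OF T lim]) auto
  then have "\<forall>\<^sub>F n in sequentially. r < T (d (u n) (u (Suc n))) r'"
    using order_tendstoD(1) r'(1) by blast
  then have "\<forall>\<^sub>F n in sequentially. \<forall>m\<ge>n. r \<le> d (u n) (u m)"
  proof (eventually_elim, intro allI impI)
    fix n m :: nat
    assume n: "r < T (d (u n) (u (Suc n))) r'" and "n \<le> m"
    from \<open>n \<le> m\<close> show "r \<le> d (u n) (u m)"
    proof (induction m rule: dec_induct)
      case base
      then show ?case using refl[OF uX] r by simp
    next
      case (step m)
      \<comment> \<open>Contractivity shifts both indices; the triangle inequality through
        \<open>u (Suc n)\<close> then brings the left one back to n.\<close>
      have "r \<le> \<psi> (d (u (Suc n)) (u (Suc m)))"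
        using contr[OF uX uX, of n m] step.IH r by (simp add: u_Suc)
      then have *: "r' \<le> d (u (Suc n)) (u (Suc m))"
        using r'(3)[OF rng[OF uX uX]] by blast
      have "T (d (u n) (u (Suc n))) r' \<le> T (d (u n) (u (Suc n))) (d (u (Suc n)) (u (Suc m)))"
        using * rng[OF uX uX] r r' by (intro T_mono) auto
      also have "\<dots> \<le> d (u n) (u (Suc m))"
        by (rule tri[OF uX uX uX])
      finally show ?case using n by simp
    qed
  qed
  then show ?thesis by (simp add: u_def)
qed

section \<open>Duality under a \<mapsto> 1 - a\<close>

lemma continuous_tnorm_conjugate:
  assumes "continuous_tconorm S"
  shows "continuous_tnorm (\<lambda>a b. 1 - S (1 - a) (1 - b))"
proof -
  have rng: "\<forall>a\<in>{0..1}. \<forall>b\<in>{0..1}. S a b \<in> {0..1}"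
    and cont: "continuous_on ({0..1} \<times> {0..1}) (\<lambda>(a, b). S a b)"
    and comm: "\<forall>a\<in>{0..1}. \<forall>b\<in>{0..1}. S a b = S b a"
    and assoc: "\<forall>a\<in>{0..1}. \<forall>b\<in>{0..1}. \<forall>c\<in>{0..1}. S (S a b) c = S a (S b c)"
    and unit: "\<forall>a\<in>{0..1}. S a 0 = a"
    and mono: "\<forall>a\<in>{0..1}. \<forall>b\<in>{0..1}. \<forall>c\<in>{0..1}. \<forall>d\<in>{0..1}.
      a \<le> c \<longrightarrow> b \<le> d \<longrightarrow> S a b \<le> S c d"
    using assms unfolding continuous_tconorm_def by blast+
  have cont': "continuous_on ({0..1} \<times> {0..1})
      (\<lambda>p. 1 - (\<lambda>(a, b). S a b) (1 - fst p, 1 - snd p :: real))"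
    by (intro continuous_intros continuous_on_compose2[OF cont]) auto
  have rng': "1 - S (1 - a) (1 - b) \<in> {0..1}"
    if "a \<in> {0..1}" "b \<in> {0..1}" for a b
    using bspec[OF bspec[OF rng], of "1 - a" "1 - b"] that by simp
  have comm': "1 - S (1 - a) (1 - b) = 1 - S (1 - b) (1 - a)"
    if "a \<in> {0..1}" "b \<in> {0..1}" for a b
    using bspec[OF bspec[OF comm], of "1 - a" "1 - b"] that by simp
  have assoc': "1 - S (1 - (1 - S (1 - a) (1 - b))) (1 - c) =
      1 - S (1 - a) (1 - (1 - S (1 - b) (1 - c)))"
    if "a \<in> {0..1}" "b \<in> {0..1}" "c \<in> {0..1}" for a b c
    using bspec[OF bspec[OF bspec[OF assoc]], of "1 - a" "1 - b" "1 - c"] that by simp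
  have unit': "1 - S (1 - a) (1 - 1) = a" if "a \<in> {0..1}" for a
    using bspec[OF unit, of "1 - a"] that by simp
  have mono': "1 - S (1 - a) (1 - b) \<le> 1 - S (1 - c) (1 - d)"
    if "a \<in> {0..1}" "b \<in> {0..1}" "c \<in> {0..1}" "d \<in> {0..1}" "a \<le> c" "b \<le> d" for a b c d
    \<comment> \<open>Conjugation reverses the order, so the larger pair \<open>c\<close>,
      \<open>d\<close> supplies the smaller arguments.\<close>
    using mono[rule_format, of "1 - c" "1 - d" "1 - a" "1 - b"] that by simp
  show ?thesis
    unfolding continuous_tnorm_def case_prod_unfold
    by (intro conjI ballI impI cont'[unfolded case_prod_unfold fst_conv snd_conv]
        rng' comm' assoc' unit' mono')
qed

lemma Psi_class_conjugate:
  assumes "\<phi> \<in> Phi_class"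
  shows "(\<lambda>t. 1 - \<phi> (1 - t)) \<in> Psi_class"
proof -
  have rng: "\<phi> \<in> {0..1} \<rightarrow> {0..1}" and cont: "continuous_on {0..1} \<phi>"
    and mono: "mono_on {0..1} \<phi>" and gt: "\<forall>t\<in>{0<..<1}. \<phi> t > t"
    using assms by (simp_all add: Phi_class_def)
  have "continuous_on {0..1} (\<lambda>t. 1 - \<phi> (1 - t))"
    by (intro continuous_intros continuous_on_compose2[OF cont]) auto
  moreover have "mono_on {0..1} (\<lambda>t. 1 - \<phi> (1 - t))"
    by (intro mono_onI diff_left_mono mono_onD[OF mono]) auto
  moreover have "1 - \<phi> (1 - t) < t" if "t \<in> {0<..<1}" for t
    using gt[rule_format, of "1 - t"] that by simp
  moreover have "1 - \<phi> (1 - t) \<in> {0..1}" if "t \<in> {0..1}" for t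
    using funcset_mem[OF rng, of "1 - t"] that by simp
  ultimately show ?thesis by (simp add: Psi_class_def)
qed

section \<open>Cauchy orbits, fixed limits and uniqueness in the space\<close>

context nonarch_ifm_space
begin

lemma orbit_M_Cauchy:
  assumes psi: "\<psi> \<in> Psi_class" and phi: "\<phi> \<in> Phi_class"
    and f: "f \<in> X \<rightarrow> X" and contr: "if_contractive X \<mu> \<nu> \<psi> \<phi> f"
    and x0: "x0 \<in> X"
  shows "M_Cauchy \<mu> \<nu> (\<lambda>n. (f ^^ n) x0)"
  unfolding M_Cauchy_def
proof (intro ballI allI impI)
  fix e t :: real
  assume e: "e \<in> {0<..<1}" and t: "0 < t"
  define u where "u n = (f ^^ n) x0" for n
  have uX: "u n \<in> X" for n
    using f x0 by (induction n) (auto simp: u_def)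
  have fx0: "f x0 \<in> X"
    using f x0 by auto
  \<comment> \<open>Halving \<open>e\<close> turns the non-strict bounds of
    \<open>orbit_Cauchy\<close> into the strict ones of \<open>M_Cauchy\<close>.\<close>
  have r: "1 - e / 2 \<in> {0<..<1}"
    using e by auto
  have "\<forall>\<^sub>F n in sequentially. \<forall>m\<ge>n. 1 - e / 2 \<le> \<mu> (u n) (u m) t"
    unfolding u_def
  proof (rule orbit_Cauchy[OF tnorm psi f x0 _ _ _ _ _ r])
    show "T (\<mu> x y t) (\<mu> y z t) \<le> \<mu> x z t" if "x \<in> X" "y \<in> X" "z \<in> X" for x y z
      using mu_triangle[OF that t t] by simp
    show "\<mu> x y t \<le> \<psi> (\<mu> (f x) (f y) t)" if "x \<in> X" "y \<in> X" "\<mu> x y t > 0" for x y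
      using contr that t by (auto simp: if_contractive_def)
  qed (use mu_range mu_pos mu_eq_1_iff x0 fx0 t in auto)
  moreover have "\<forall>\<^sub>F n in sequentially. \<forall>m\<ge>n. 1 - e / 2 \<le> 1 - \<nu> (u n) (u m) t"
    unfolding u_def
  proof (rule orbit_Cauchy[OF continuous_tnorm_conjugate[OF tconorm]
        Psi_class_conjugate[OF phi] f x0 _ _ _ _ _ r])
    show "1 - \<nu> x0 (f x0) t > 0"
      using mu_nu_le_1[OF x0 fx0 t] mu_pos[OF x0 fx0 t] by simp
    show "1 - S (1 - (1 - \<nu> x y t)) (1 - (1 - \<nu> y z t)) \<le> 1 - \<nu> x z t"
      if "x \<in> X" "y \<in> X" "z \<in> X" for x y z
      using nu_triangle[OF that t t] by simp
    show "1 - \<nu> x y t \<le> 1 - \<phi> (1 - (1 - \<nu> (f x) (f y) t))"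
      if "x \<in> X" "y \<in> X" "1 - \<nu> x y t > 0" for x y
      using contr that t by (auto simp: if_contractive_def)
  qed (use nu_range nu_eq_0_iff t in auto)
  ultimately have "\<forall>\<^sub>F n in sequentially. \<forall>m\<ge>n.
      1 - e / 2 \<le> \<mu> (u n) (u m) t \<and> \<nu> (u n) (u m) t \<le> e / 2"
    by eventually_elim auto
  then obtain n0 where n0: "\<And>n m. n0 \<le> n \<Longrightarrow> n \<le> m \<Longrightarrow>
      1 - e / 2 \<le> \<mu> (u n) (u m) t \<and> \<nu> (u n) (u m) t \<le> e / 2"
    unfolding eventually_sequentially by blast
  \<comment> \<open>The bounds so far cover only \<open>n \<le> m\<close>; symmetry of \<mu> and
    \<nu> gives the other order.\<close>
  have "\<mu> (u n) (u m) t > 1 - e \<and> \<nu> (u n) (u m) t < e" if "n0 \<le> m" "n0 \<le> n" for m n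
  proof (cases "n \<le> m")
    case True
    then show ?thesis using n0[of n m] that e by auto
  next
    case False
    then show ?thesis
      using n0[of m n] that e mu_sym[OF uX uX t, of n m] nu_sym[OF uX uX t, of n m] by auto
  qed
  then show "\<exists>n0. \<forall>m\<ge>n0. \<forall>n\<ge>n0.
      \<mu> ((f ^^ n) x0) ((f ^^ m) x0) t > 1 - e \<and> \<nu> ((f ^^ n) x0) ((f ^^ m) x0) t < e"
    by (auto simp: u_def)
qed

text \<open>Contractivity squeezes \<open>\<mu> (u (Suc n)) (f x) 1\<close> between
  \<open>\<mu> (u n) x 1\<close> and 1, so the triangle inequality through \<open>u (Suc n)\<close>
  forces \<open>\<mu> x (f x) 1 = 1\<close>. The single parameter 1 suffices because \<mu> = 1 at
  one parameter already means equality.\<close>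

lemma orbit_limit_fixed:
  assumes psi: "\<psi> \<in> Psi_class" and f: "f \<in> X \<rightarrow> X"
    and contr: "if_contractive X \<mu> \<nu> \<psi> \<phi> f" and x0: "x0 \<in> X"
    and x: "x \<in> X" and conv: "ifm_converges \<mu> \<nu> (\<lambda>n. (f ^^ n) x0) x"
  shows "f x = x"
proof -
  define u where "u n = (f ^^ n) x0" for n
  have uX: "u n \<in> X" for n
    using f x0 by (induction n) (auto simp: u_def)
  have fx: "f x \<in> X"
    using f x by auto
  have lim: "(\<lambda>n. \<mu> (u n) x 1) \<longlonglongrightarrow> 1"
    using conv by (simp add: ifm_converges_def u_def)
  have le: "\<mu> (u n) x 1 \<le> \<mu> (u (Suc n)) (f x) 1" for n
  proof -
    have "\<mu> (u n) x 1 \<le> \<psi> (\<mu> (u (Suc n)) (f x) 1)"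
      using contr uX[of n] x mu_pos[OF uX x, of 1] by (auto simp: if_contractive_def u_def)
    also have "\<dots> \<le> \<mu> (u (Suc n)) (f x) 1"
      by (intro Psi_class_le[OF psi] mu_range uX fx) simp
    finally show ?thesis .
  qed
  have lim1: "(\<lambda>n. \<mu> (u (Suc n)) (f x) 1) \<longlonglongrightarrow> 1"
    using le mu_range[OF uX fx] by (intro tendsto_sandwich[OF _ _ lim tendsto_const]) auto
  have "(\<lambda>n. \<mu> x (u (Suc n)) 1) \<longlonglongrightarrow> 1"
    using LIMSEQ_Suc[OF lim] mu_sym[OF uX x] by simp
  then have "(\<lambda>n. T (\<mu> x (u (Suc n)) 1) (\<mu> (u (Suc n)) (f x) 1)) \<longlonglongrightarrow> 1"
    using lim1 by (intro continuous_tnorm_LIMSEQ[OF tnorm] mu_range uX fx x) auto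
  then have "1 \<le> \<mu> x (f x) 1"
    using mu_triangle[OF x uX fx, of 1 1] by (intro LIMSEQ_le_const2) auto
  then have "\<mu> x (f x) 1 = 1"
    using mu_range[OF x fx, of 1] by simp
  then show ?thesis
    using mu_eq_1_iff[OF x fx, of 1] by simp
qed

text \<open>At two fixed points contractivity reads \<open>s \<le> \<psi> s\<close> for the positive
  number \<open>s = \<mu> x y 1\<close>, which leaves only s = 1.\<close>

lemma fixed_point_unique:
  assumes "\<psi> \<in> Psi_class" and "if_contractive X \<mu> \<nu> \<psi> \<phi> f"
    and x: "x \<in> X" "f x = x" and y: "y \<in> X" "f y = y"
  shows "x = y"
proof -
  have "\<mu> x y 1 \<le> \<psi> (\<mu> x y 1)"
    using assms mu_pos[OF x(1) y(1), of 1] unfolding if_contractive_def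
    by (metis zero_less_one)
  then have "\<mu> x y 1 = 1"
    using Psi_class_le_imp_eq_1[OF assms(1)] mu_pos[OF x(1) y(1), of 1] mu_range[OF x(1) y(1), of 1]
    by auto
  then show ?thesis
    using mu_eq_1_iff[OF x(1) y(1), of 1] by simp
qed

end

theorem theorem4p1:
  fixes X :: "'a set"
    and \<mu> \<nu> :: "'a \<Rightarrow> 'a \<Rightarrow> real \<Rightarrow> real"
    and T S :: "real \<Rightarrow> real \<Rightarrow> real"
    and \<psi> \<phi> :: "real \<Rightarrow> real"
    and f :: "'a \<Rightarrow> 'a"
  assumes "nonarch_ifm_space X \<mu> \<nu> T S"
    and "M_complete X \<mu> \<nu>"
    and "\<psi> \<in> Psi_class"
    and "\<phi> \<in> Phi_class"
    and "f \<in> X \<rightarrow> X"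
    and "if_contractive X \<mu> \<nu> \<psi> \<phi> f"
    and "\<exists>x\<in>X. \<forall>t>0. \<mu> x (f x) t > 0 \<and> \<nu> x (f x) t < 1"
  shows "\<exists>!x. x \<in> X \<and> f x = x"
proof -
  interpret nonarch_ifm_space X \<mu> \<nu> T S by (rule assms(1))
  obtain x0 where x0: "x0 \<in> X"
    using assms(7) by blast
  have "(f ^^ n) x0 \<in> X" for n
    using assms(5) x0 by (induction n) auto
  then obtain x where x: "x \<in> X" "ifm_converges \<mu> \<nu> (\<lambda>n. (f ^^ n) x0) x"
    using assms(2)[unfolded M_complete_def, rule_format, of "\<lambda>n. (f ^^ n) x0"]
      orbit_M_Cauchy[OF assms(3-6) x0] by auto
  have "f x = x"
    by (rule orbit_limit_fixed[OF assms(3,5,6) x0 x])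
  then show ?thesis
    using x(1) fixed_point_unique[OF assms(3,6)] by blast
qed

end
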